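(* Let $n\in\mathbb N$ and let $d\in\Delta^{n-1}$ with $d>0$ (all entries positive) be such that $\frac{d_{j+1}}{d_j}$ is constant for $j=1,\dots,n-1$. Let $\mathbf{\Gamma}_d$ be the GKSL operator on $\mathbb C^{n\times n}$ generated by $$\sigma_+^d=\sum_{k=1}^{n-1}\sqrt{k(n-k)}\cos(\theta_k)\,e_ke_{k+1}^T,\qquad \sigma_-^d=\sum_{k=1}^{n-1}\sqrt{k(n-k)}\sin(\theta_k)\,e_{k+1}e_k^T,$$ where $\theta_k=\arccos\big((1+\frac{d_{k+1}}{d_k})^{-1/2}\big)\in(0,\frac\pi2)$, and let $B_0=B_0(\mathbf{\Gamma}_d)\in\mathbb R^{n\times n}$ be its matrix representation on diagonal matrices. Then the reachable set of $d$ for the toy model $\Lambda_d$ on $\Delta^{n-1}$ with dissipative generator $B_0$ satisfies $$\mathfrak{reach}_{\Lambda_d}(d)\subseteq\{x\in\Delta^{n-1} : x\prec d\}.$$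
   Context: $\Delta^{n-1}=\{x\in\mathbb R^n : x_i\ge 0 \text{ for all } i,\ \sum_{i=1}^n x_i=1\}$ is the standard simplex and $(e_k)_{k=1}^n$ is the standard basis. Majorization: for $x,y\in\mathbb R^n$, $x\prec y$ means that for each $k=1,\dots,n$ the sum of the $k$ largest entries of $x$ is at most the sum of the $k$ largest entries of $y$, with equality for $k=n$. GKSL operator: given matrices $V_1,\dots,V_r\in\mathbb C^{n\times n}$, the GKSL operator generated by them is the linear map on $\mathbb C^{n\times n}$ $$\mathbf{\Gamma}(\rho)=\sum_k\Big(\tfrac12\big(V_k^\dagger V_k\rho+\rho V_k^\dagger V_k\big)-V_k\rho V_k^\dagger\Big).$$ If $\mathbf{\Gamma}$ maps diagonal matrices to diagonal matrices (as is the case here), $B_0(\mathbf{\Gamma})$ denotes the matrix determined by $\operatorname{diag}(B_0(\mathbf{\Gamma})x)=\mathbf{\Gamma}(\operatorname{diag}(x))$ for all vectors $x$. Toy model: given $B_0\in\mathbb R^{n\times n}$ such that $e^{-tB_0}$ leaves $\Delta^{n-1}$ invariant for all $t\ge0$, the toy model $\Lambda$ with dissipative generator $B_0$ is the hybrid control system $$\dot x(t)=-B_0x(t),\ x(t_k)=x_k,\ t\in[t_k,t_{k+1});\qquad x_0\in\Delta^{n-1},\ x_{k+1}=\pi_k e^{-(t_{k+1}-t_k)B_0}x_k,\ k\ge0,$$ whose controls are the switching times $0=t_0\le t_1\le t_2\le\dots$ (not accumulating on finite intervals) and the $n\times n$ permutation matrices $\pi_k$. Its reachable set $\mathfrak{reach}_\Lambda(x_0)=\{x(t):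 x(\cdot)\text{ a solution},\,t\ge0\}$ equals $\mathcal S_\Lambda x_0$, where $\mathcal S_\Lambda\subset\mathbb R^{n\times n}$ is the matrix semigroup generated by $\{e^{-tB_0}: t\ge0\}$ and all $n\times n$ permutation matrices. *)

theory Defs
  imports "HOL-Analysis.Analysis" "HOL-Combinatorics.Permutations"
    "Jordan_Normal_Form.Schur_Decomposition"
begin

text \<open>
  Vectors and matrices are those of Jordan-Normal-Form, so the dimension is an ordinary
  natural number and indices run from 0 to n - 1: the mathematical entry x_k is
  the component at index k - 1.
\<close>

definition std_simplex :: "nat \<Rightarrow> real vec set" where
  "std_simplex n = {x \<in> carrier_vec n. (\<forall>i<n. 0 \<le> x $ i) \<and> (\<Sum>i<n. x $ i) = 1}"

definition sum_largest :: "nat \<Rightarrow> real vec \<Rightarrow> real" where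
  "sum_largest k x = sum_list (take k (rev (sort (list_of_vec x))))"

definition majorized :: "nat \<Rightarrow> real vec \<Rightarrow> real vec \<Rightarrow> bool" where
  "majorized n x y \<longleftrightarrow> x \<in> carrier_vec n \<and> y \<in> carrier_vec n \<and>
     (\<forall>k\<in>{1..n}. sum_largest k x \<le> sum_largest k y) \<and> sum_largest n x = sum_largest n y"

definition mat_exp :: "real mat \<Rightarrow> real mat" where
  "mat_exp A = mat (dim_row A) (dim_row A) (\<lambda>(i, j). \<Sum>m. (A ^\<^sub>m m) $$ (i, j) / fact m)"

definition permutation_mats :: "nat \<Rightarrow> real mat set" where
  "permutation_mats n =
     {mat n n (\<lambda>(i, j). if i = p j then 1 else 0) | p. p permutes {..<n}}"

definition gksl :: "nat \<Rightarrow> complex mat list \<Rightarrow> complex mat \<Rightarrow> complex mat" where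
  "gksl n Vs \<rho> = foldr (+)
     (map (\<lambda>V. (1/2) \<cdot>\<^sub>m (mat_adjoint V * V * \<rho> + \<rho> * (mat_adjoint V * V)) - V * \<rho> * mat_adjoint V) Vs)
     (0\<^sub>m n n)"

definition diag_of_vec :: "complex vec \<Rightarrow> complex mat" where
  "diag_of_vec x = mat_diag (dim_vec x) (\<lambda>i. x $ i)"

text \<open>
  The real matrix determined by the action of a superoperator on diagonal matrices; the
  value is unspecified unless there is exactly one such matrix.
\<close>

definition B0 :: "nat \<Rightarrow> (complex mat \<Rightarrow> complex mat) \<Rightarrow> real mat" where
  "B0 n \<Gamma> = (THE B. B \<in> carrier_mat n n \<and>
     (\<forall>x\<in>carrier_vec n. diag_of_vec (map_mat complex_of_real B *\<^sub>v x) = \<Gamma> (diag_of_vec x)))"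

definition dissipative_generator :: "nat \<Rightarrow> real mat \<Rightarrow> bool" where
  "dissipative_generator n B \<longleftrightarrow> B \<in> carrier_mat n n \<and>
     (\<forall>t\<ge>0. \<forall>x\<in>std_simplex n. mat_exp ((- t) \<cdot>\<^sub>m B) *\<^sub>v x \<in> std_simplex n)"

text \<open>
  Here \<open>\<tau>\<close> are the switching times, \<open>P\<close> the permutation matrices and \<open>xs\<close> the post-switch
  states. When consecutive switching times coincide, the interval between them is empty and
  imposes no condition on \<open>x\<close>, so that several switches may happen at one instant. The
  derivative at the left end of each interval is one-sided.
\<close>

definition toy_solution ::
  "nat \<Rightarrow> real mat \<Rightarrow> real vec \<Rightarrow> (nat \<Rightarrow> real) \<Rightarrow> (nat \<Rightarrow> real mat) \<Rightarrow> (nat \<Rightarrow> real vec) \<Rightarrow>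
   (real \<Rightarrow> real vec) \<Rightarrow> bool" where
  "toy_solution n B x0 \<tau> P xs x \<longleftrightarrow>
     x0 \<in> std_simplex n \<and>
     \<tau> 0 = 0 \<and> (\<forall>k. \<tau> k \<le> \<tau> (Suc k)) \<and> (\<forall>T. finite {k. \<tau> k \<le> T}) \<and>
     (\<forall>k. P k \<in> permutation_mats n) \<and>
     xs 0 = x0 \<and>
     (\<forall>k. xs (Suc k) = P k *\<^sub>v (mat_exp ((- (\<tau> (Suc k) - \<tau> k)) \<cdot>\<^sub>m B) *\<^sub>v xs k)) \<and>
     (\<forall>t\<ge>0. x t \<in> carrier_vec n) \<and>
     (\<forall>k. \<tau> k < \<tau> (Suc k) \<longrightarrow> x (\<tau> k) = xs k) \<and>
     (\<forall>k. \<forall>t\<in>{\<tau> k..<\<tau> (Suc k)}. \<forall>i<n.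
        ((\<lambda>s. x s $ i) has_real_derivative - ((B *\<^sub>v x t) $ i)) (at t within {\<tau> k..<\<tau> (Suc k)}))"

definition reach :: "nat \<Rightarrow> real mat \<Rightarrow> real vec \<Rightarrow> real vec set" where
  "reach n B x0 = {x t | \<tau> P xs x t. toy_solution n B x0 \<tau> P xs x \<and> 0 \<le> t}"

text \<open>In the following k is the 1-based mathematical index, 1 <= k <= n - 1.\<close>

definition theta :: "real vec \<Rightarrow> nat \<Rightarrow> real" where
  "theta d k = arccos ((1 + d $ k / d $ (k - 1)) powr (- 1 / 2))"

definition sigma_plus :: "nat \<Rightarrow> real vec \<Rightarrow> complex mat" where
  "sigma_plus n d = mat n n (\<lambda>(i, j). if j = Suc i
     then (let k = Suc i in complex_of_real (sqrt (real (k * (n - k))) * cos (theta d k))) else 0)"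

definition sigma_minus :: "nat \<Rightarrow> real vec \<Rightarrow> complex mat" where
  "sigma_minus n d = mat n n (\<lambda>(i, j). if i = Suc j
     then (let k = Suc j in complex_of_real (sqrt (real (k * (n - k))) * sin (theta d k))) else 0)"

end

theory Submission
  imports Defs
begin

text \<open>
  On diagonals the generator \<open>B\<close> is tridiagonal, with one flux between each pair of neighbouring
  entries that is proportional to \<open>q x_i - x_(i+1)\<close>, where \<open>q\<close> is the ratio of \<open>d\<close>. Consider the
  vectors all of whose sums over \<open>k\<close> entries are at most \<open>F k\<close>. If such a bound is attained for an
  index set \<open>I\<close>, then the entries inside and outside \<open>I\<close> are separated by two consecutive
  increments of \<open>F\<close>. When the ratio of these increments is at least \<open>max q (1/q)\<close>, every flux across
  the boundary of \<open>I\<close> leaves \<open>I\<close>. With an explicit slack in place of equality, this shows that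
  \<open>M = 1 - h B\<close> preserves the set for small \<open>h\<close>, and \<open>exp (-t B)\<close> is a Poisson average of the
  powers of \<open>M\<close>. Taking \<open>F k\<close> to be the sum of the \<open>k\<close> largest entries of \<open>d\<close> yields
  majorization by \<open>d\<close>; taking \<open>F k = min 1 k\<close> yields the simplex.
\<close>

unbundle no vec_syntax

subsection \<open>Matrix exponentials and linear differential equations\<close>

lemma mult_mat_vec_index_sum:
  assumes "A \<in> carrier_mat n n" "x \<in> carrier_vec n" "i < n"
  shows "(A *\<^sub>v x) $ i = (\<Sum>j<n. A $$ (i, j) * x $ j)"
  using assms by (simp add: scalar_prod_def lessThan_atLeast0)

lemma mult_mat_index_sum:
  assumes "A \<in> carrier_mat n n" "C \<in> carrier_mat n n" "i < n" "j < n"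
  shows "(A * C) $$ (i, j) = (\<Sum>k<n. A $$ (i, k) * C $$ (k, j))"
  using assms by (simp add: scalar_prod_def lessThan_atLeast0)

lemma pow_mat_Suc_left:
  assumes "A \<in> carrier_mat n n"
  shows "A ^\<^sub>m Suc m = A * A ^\<^sub>m m"
proof (induction m)
  case 0
  then show ?case using assms by simp
next
  case (Suc m)
  have "A ^\<^sub>m Suc (Suc m) = (A * A ^\<^sub>m m) * A"
    using Suc by simp
  also have "\<dots> = A * (A ^\<^sub>m m * A)"
    using assms by (intro assoc_mult_mat[of _ n n _ n _ n] pow_carrier_mat)
  finally show ?case by simp
qed

lemma pow_mat_smult:
  fixes A :: "real mat"
  assumes "A \<in> carrier_mat n n"
  shows "(t \<cdot>\<^sub>m A) ^\<^sub>m m = t ^ m \<cdot>\<^sub>m A ^\<^sub>m m"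
proof (induction m)
  case 0
  then show ?case using assms by auto
next
  case (Suc m)
  have A': "A ^\<^sub>m m \<in> carrier_mat n n"
    using assms by (rule pow_carrier_mat)
  have "(t \<cdot>\<^sub>m A) ^\<^sub>m Suc m = t ^ m \<cdot>\<^sub>m (t \<cdot>\<^sub>m (A ^\<^sub>m m * A))"
    using A' assms Suc
    by (simp add: mult_smult_assoc_mat[OF A', of _ n] mult_smult_distrib[OF A', of _ n])
  also have "\<dots> = t ^ Suc m \<cdot>\<^sub>m A ^\<^sub>m Suc m"
    by (rule eq_matI) simp_all
  finally show ?case .
qed

text \<open>The witness is the sum of the absolute values of all entries. It dominates every
  absolute row sum, so each further factor \<open>A\<close> costs at most a factor
  \<open>C\<close>.\<close>

lemma pow_mat_entry_bound:
  fixes A :: "real mat"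
  assumes "A \<in> carrier_mat n n"
  obtains C where "\<And>m i j. \<lbrakk>i < n; j < n\<rbrakk> \<Longrightarrow> \<bar>(A ^\<^sub>m m) $$ (i, j)\<bar> \<le> C ^ m"
proof
  define C where "C = (\<Sum>i<n. \<Sum>j<n. \<bar>A $$ (i, j)\<bar>)"
  fix m i j
  assume "i < n" "j < n"
  then show "\<bar>(A ^\<^sub>m m) $$ (i, j)\<bar> \<le> (\<Sum>i<n. \<Sum>j<n. \<bar>A $$ (i, j)\<bar>) ^ m"
    unfolding C_def[symmetric]
  proof (induction m arbitrary: i j)
    case 0
    then show ?case using assms by simp
  next
    case (Suc m)
    have C0: "0 \<le> C"
      unfolding C_def by (intro sum_nonneg) auto
    have row: "(\<Sum>k<n. \<bar>A $$ (i, k)\<bar>) \<le> C"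
      unfolding C_def using Suc.prems
      by (intro member_le_sum[of i _ "\<lambda>i. \<Sum>k<n. \<bar>A $$ (i, k)\<bar>"]) (auto intro: sum_nonneg)
    have "(A ^\<^sub>m Suc m) $$ (i, j) = (\<Sum>k<n. A $$ (i, k) * (A ^\<^sub>m m) $$ (k, j))"
      unfolding pow_mat_Suc_left[OF assms] using assms Suc.prems
      by (intro mult_mat_index_sum pow_carrier_mat)
    also have "\<bar>\<dots>\<bar> \<le> (\<Sum>k<n. \<bar>A $$ (i, k)\<bar> * C ^ m)"
      using Suc by (intro order_trans[OF sum_abs] sum_mono) (simp add: abs_mult mult_left_mono)
    also have "\<dots> \<le> C * C ^ m"
      unfolding sum_distrib_right[symmetric] using row C0 by (intro mult_right_mono) auto
    finally show ?case by simp
  qed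
qed

lemma summable_pow_mat_entry:
  fixes A :: "real mat"
  assumes "A \<in> carrier_mat n n" "i < n" "j < n"
  shows "summable (\<lambda>m. (A ^\<^sub>m m) $$ (i, j) / fact m * t ^ m)"
proof -
  obtain C where C: "\<And>m i j. \<lbrakk>i < n; j < n\<rbrakk> \<Longrightarrow> \<bar>(A ^\<^sub>m m) $$ (i, j)\<bar> \<le> C ^ m"
    using pow_mat_entry_bound[OF assms(1)] by blast
  show ?thesis
  proof (rule summable_comparison_test'[where N = 0])
    show "summable (\<lambda>m. inverse (fact m) * (C * \<bar>t\<bar>) ^ m)"
      by (rule summable_exp)
    fix m
    have "norm ((A ^\<^sub>m m) $$ (i, j) / fact m * t ^ m) = \<bar>(A ^\<^sub>m m) $$ (i, j)\<bar> * (\<bar>t\<bar> ^ m / fact m)"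
      by (simp add: abs_mult power_abs)
    also have "\<dots> \<le> C ^ m * (\<bar>t\<bar> ^ m / fact m)"
      using C assms by (intro mult_right_mono) auto
    finally show "norm ((A ^\<^sub>m m) $$ (i, j) / fact m * t ^ m) \<le> inverse (fact m) * (C * \<bar>t\<bar>) ^ m"
      by (simp add: power_mult_distrib field_simps)
  qed
qed

section \<open>The matrix exponential as a power series in time\<close>

lemma mat_exp_carrier [simp]:
  "A \<in> carrier_mat n n \<Longrightarrow> mat_exp A \<in> carrier_mat n n"
  by (auto simp: mat_exp_def)

text \<open>Pulling \<open>t\<close> out of the matrix power leaves a scalar power series in
  \<open>t\<close> with fixed coefficients, which can be differentiated term by term.\<close>

lemma mat_exp_smult_entry:
  assumes "A \<in> carrier_mat n n" "i < n" "j < n"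
  shows "mat_exp (t \<cdot>\<^sub>m A) $$ (i, j) = (\<Sum>m. (A ^\<^sub>m m) $$ (i, j) / fact m * t ^ m)"
proof -
  have "((t \<cdot>\<^sub>m A) ^\<^sub>m m) $$ (i, j) = t ^ m * (A ^\<^sub>m m) $$ (i, j)" for m
    using assms pow_carrier_mat[OF assms(1), of m] by (simp add: pow_mat_smult)
  then show ?thesis
    using assms by (simp add: mat_exp_def mult.commute)
qed

lemma mat_exp_smult_sums:
  assumes "A \<in> carrier_mat n n" "i < n" "j < n"
  shows "(\<lambda>m. (A ^\<^sub>m m) $$ (i, j) / fact m * t ^ m) sums mat_exp (t \<cdot>\<^sub>m A) $$ (i, j)"
  using summable_pow_mat_entry[OF assms] mat_exp_smult_entry[OF assms] by (simp add: summable_sums)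

lemma mat_exp_zero:
  assumes "A \<in> carrier_mat n n"
  shows "mat_exp (0 \<cdot>\<^sub>m A) = 1\<^sub>m n"
proof (rule eq_matI)
  fix i j
  assume "i < dim_row (1\<^sub>m n :: real mat)" "j < dim_col (1\<^sub>m n :: real mat)"
  then show "mat_exp (0 \<cdot>\<^sub>m A) $$ (i, j) = 1\<^sub>m n $$ (i, j)"
    using assms by (subst mat_exp_smult_entry) (auto simp: powser_zero[of "\<lambda>m. (A ^\<^sub>m m) $$ (i, j) / fact m"] simp del: times_divide_eq_left)
qed (use assms in \<open>auto simp: mat_exp_def\<close>)

text \<open>The formally differentiated series has coefficients
  \<open>(A ^\<^sub>m Suc m) $$ (i, j) / fact m\<close>. Splitting off one factor \<open>A\<close>
  on the left or on the right sums this same series to either product, which gives the derivative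
  and the commutation at once.\<close>

lemma has_real_derivative_mat_exp:
  assumes "A \<in> carrier_mat n n" "i < n" "j < n"
  shows "((\<lambda>t. mat_exp (t \<cdot>\<^sub>m A) $$ (i, j)) has_real_derivative (A * mat_exp (t \<cdot>\<^sub>m A)) $$ (i, j)) (at t)"
    and "(A * mat_exp (t \<cdot>\<^sub>m A)) $$ (i, j) = (mat_exp (t \<cdot>\<^sub>m A) * A) $$ (i, j)"
proof -
  define c where "c m = (A ^\<^sub>m m) $$ (i, j) / fact m" for m
  have E: "mat_exp (t \<cdot>\<^sub>m A) \<in> carrier_mat n n" for t
    using assms by simp
  have diffs: "diffs c m = (A ^\<^sub>m Suc m) $$ (i, j) / fact m" for m
    unfolding diffs_def c_def fact_Suc by (simp del: pow_mat.simps)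
  have "(\<lambda>m. \<Sum>k<n. A $$ (i, k) * ((A ^\<^sub>m m) $$ (k, j) / fact m * t ^ m)) sums
      (\<Sum>k<n. A $$ (i, k) * mat_exp (t \<cdot>\<^sub>m A) $$ (k, j))"
    using assms by (intro sums_sum sums_mult mat_exp_smult_sums) auto
  also have "(\<lambda>m. \<Sum>k<n. A $$ (i, k) * ((A ^\<^sub>m m) $$ (k, j) / fact m * t ^ m)) = (\<lambda>m. diffs c m * t ^ m)"
    unfolding diffs pow_mat_Suc_left[OF assms(1)]
    by (intro ext, subst mult_mat_index_sum[OF assms(1) pow_carrier_mat[OF assms(1)] assms(2,3)])
      (simp add: sum_distrib_left sum_divide_distrib mult_ac)
  finally have left: "(\<lambda>m. diffs c m * t ^ m) sums (A * mat_exp (t \<cdot>\<^sub>m A)) $$ (i, j)"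
    using mult_mat_index_sum[OF assms(1) E assms(2,3)] by simp
  have "(\<lambda>m. \<Sum>k<n. (A ^\<^sub>m m) $$ (i, k) / fact m * t ^ m * A $$ (k, j)) sums
      (\<Sum>k<n. mat_exp (t \<cdot>\<^sub>m A) $$ (i, k) * A $$ (k, j))"
    using assms by (intro sums_sum sums_mult2 mat_exp_smult_sums) auto
  also have "(\<lambda>m. \<Sum>k<n. (A ^\<^sub>m m) $$ (i, k) / fact m * t ^ m * A $$ (k, j)) = (\<lambda>m. diffs c m * t ^ m)"
    unfolding diffs pow_mat.simps
    by (intro ext, subst mult_mat_index_sum[OF pow_carrier_mat[OF assms(1)] assms(1) assms(2,3)])
      (simp add: sum_distrib_left sum_divide_distrib mult_ac)
  finally have "(\<lambda>m. diffs c m * t ^ m) sums (mat_exp (t \<cdot>\<^sub>m A) * A) $$ (i, j)"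
    using mult_mat_index_sum[OF E assms(1) assms(2,3)] by simp
  with left show "(A * mat_exp (t \<cdot>\<^sub>m A)) $$ (i, j) = (mat_exp (t \<cdot>\<^sub>m A) * A) $$ (i, j)"
    by (rule sums_unique2)
  have "((\<lambda>t. \<Sum>m. c m * t ^ m) has_real_derivative (\<Sum>m. diffs c m * t ^ m)) (at t)"
    using summable_pow_mat_entry[OF assms] unfolding c_def
    by (rule termdiffs_strong_converges_everywhere)
  then show "((\<lambda>t. mat_exp (t \<cdot>\<^sub>m A) $$ (i, j)) has_real_derivative (A * mat_exp (t \<cdot>\<^sub>m A)) $$ (i, j)) (at t)"
    unfolding mat_exp_smult_entry[OF assms] c_def[symmetric] by (simp add: sums_unique[OF left])
qed

text \<open>The curve \<open>s\<close> to \<open>exp ((b - s) A) y(s)\<close> is constant: the two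
  terms of the product rule cancel, since \<open>A\<close> commutes with its exponential. Comparing
  its values at \<open>a\<close> and \<open>b\<close> gives the formula.\<close>

lemma linear_ode_solution_eq_mat_exp:
  assumes A: "A \<in> carrier_mat n n" and "a \<le> b"
    and y: "\<And>s. s \<in> {a..b} \<Longrightarrow> y s \<in> carrier_vec n"
    and deriv: "\<And>s i. \<lbrakk>s \<in> {a..b}; i < n\<rbrakk> \<Longrightarrow>
      ((\<lambda>s. y s $ i) has_real_derivative (A *\<^sub>v y s) $ i) (at s within {a..b})"
  shows "y b = mat_exp ((b - a) \<cdot>\<^sub>m A) *\<^sub>v y a"
proof (rule eq_vecI)
  let ?E = "\<lambda>s. mat_exp ((b - s) \<cdot>\<^sub>m A)"
  have E: "?E s \<in> carrier_mat n n" for s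
    using A by simp
  then show "dim_vec (y b) = dim_vec (?E a *\<^sub>v y a)"
    using y[of b] \<open>a \<le> b\<close> by (metis atLeastAtMost_iff carrier_matD(1) carrier_vecD dim_mult_mat_vec order_refl)
  fix i
  assume "i < dim_vec (?E a *\<^sub>v y a)"
  then have i: "i < n" using E[of a] by auto
  define u where "u s = (\<Sum>j<n. ?E s $$ (i, j) * y s $ j)" for s
  have "(u has_real_derivative 0) (at s within {a..b})" if s: "s \<in> {a..b}" for s
  proof -
    have dE: "((\<lambda>s. ?E s $$ (i, j)) has_real_derivative (?E s * A) $$ (i, j) * (-1)) (at s within {a..b})"
      if "j < n" for j
    proof (rule DERIV_chain2[where f = "\<lambda>t. mat_exp (t \<cdot>\<^sub>m A) $$ (i, j)"])
      show "((\<lambda>t. mat_exp (t \<cdot>\<^sub>m A) $$ (i, j)) has_real_derivative (?E s * A) $$ (i, j)) (at (b - s))"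
        using has_real_derivative_mat_exp[OF A i that, of "b - s"] by simp
      show "((\<lambda>s. b - s) has_real_derivative - 1) (at s within {a..b})"
        by (auto intro!: derivative_eq_intros)
    qed
    have "(u has_real_derivative (\<Sum>j<n. (?E s * A) $$ (i, j) * (-1) * y s $ j +
        (A *\<^sub>v y s) $ j * ?E s $$ (i, j))) (at s within {a..b})"
      unfolding u_def by (intro DERIV_sum DERIV_mult dE deriv s) auto
    also have "(\<Sum>j<n. (?E s * A) $$ (i, j) * (-1) * y s $ j + (A *\<^sub>v y s) $ j * ?E s $$ (i, j)) =
        (\<Sum>j<n. ?E s $$ (i, j) * (A *\<^sub>v y s) $ j) - (\<Sum>j<n. (?E s * A) $$ (i, j) * y s $ j)"
      by (simp add: sum_subtractf[symmetric] mult.commute)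
    also have "\<dots> = (?E s *\<^sub>v (A *\<^sub>v y s)) $ i - ((?E s * A) *\<^sub>v y s) $ i"
      using mult_mat_vec_index_sum[OF E mult_mat_vec_carrier[OF A y[OF s]] i, of s]
        mult_mat_vec_index_sum[OF mult_carrier_mat[OF E A] y[OF s] i, of s] by simp
    also have "\<dots> = 0"
      using A E[of s] y[OF s] by (simp add: assoc_mult_mat_vec[of _ n n _ n])
    finally show ?thesis .
  qed
  then obtain c where "\<forall>s\<in>{a..b}. u s = c"
    using has_field_derivative_zero_constant[of "{a..b}" u] by auto
  then have "u b = u a"
    using \<open>a \<le> b\<close> by simp
  moreover have u: "u s = (?E s *\<^sub>v y s) $ i" if "s \<in> {a..b}" for s
    unfolding u_def using E y[OF that] i by (subst mult_mat_vec_index_sum) auto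
  ultimately show "y b $ i = (?E a *\<^sub>v y a) $ i"
    using \<open>a \<le> b\<close> mat_exp_zero[OF A] y[of b] by simp
qed

text \<open>Both sides solve \<open>y' = (M - 1) y\<close> with initial value \<open>x\<close>, so
  the uniqueness result applies and no product formula for exponentials is required.\<close>

lemma mat_exp_diff_one:
  assumes M: "M \<in> carrier_mat n n" and x: "x \<in> carrier_vec n" and "0 \<le> t"
  shows "mat_exp (t \<cdot>\<^sub>m (M - 1\<^sub>m n)) *\<^sub>v x = exp (- t) \<cdot>\<^sub>v (mat_exp (t \<cdot>\<^sub>m M) *\<^sub>v x)"
proof -
  define y where "y s = exp (- s) \<cdot>\<^sub>v (mat_exp (s \<cdot>\<^sub>m M) *\<^sub>v x)" for s
  have E: "mat_exp (s \<cdot>\<^sub>m M) \<in> carrier_mat n n" for s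
    using M by simp
  then have Ex: "mat_exp (s \<cdot>\<^sub>m M) *\<^sub>v x \<in> carrier_vec n" for s
    using mult_mat_vec_carrier x by blast
  then have y: "y s \<in> carrier_vec n" for s
    unfolding y_def by simp
  have "y t = mat_exp ((t - 0) \<cdot>\<^sub>m (M - 1\<^sub>m n)) *\<^sub>v y 0"
  proof (rule linear_ode_solution_eq_mat_exp)
    fix s i
    assume i: "i < n"
    have entry: "(mat_exp (s \<cdot>\<^sub>m M) *\<^sub>v x) $ i = (\<Sum>j<n. mat_exp (s \<cdot>\<^sub>m M) $$ (i, j) * x $ j)" for s
      using E x i by (rule mult_mat_vec_index_sum)
    have yi: "(\<lambda>s. y s $ i) = (\<lambda>s. exp (- s) * (\<Sum>j<n. mat_exp (s \<cdot>\<^sub>m M) $$ (i, j) * x $ j))"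
      using Ex i entry unfolding y_def by (metis (no_types, lifting) carrier_vecD index_smult_vec(1))
    have "((\<lambda>s. y s $ i) has_real_derivative
        - exp (- s) * (\<Sum>j<n. mat_exp (s \<cdot>\<^sub>m M) $$ (i, j) * x $ j) +
        (\<Sum>j<n. (M * mat_exp (s \<cdot>\<^sub>m M)) $$ (i, j) * x $ j) * exp (- s)) (at s within {0..t})"
      unfolding yi
      by (intro DERIV_mult DERIV_sum DERIV_cmult_right
          DERIV_subset[OF has_real_derivative_mat_exp(1)[OF M i]])
        (auto intro!: derivative_eq_intros)
    also have "- exp (- s) * (\<Sum>j<n. mat_exp (s \<cdot>\<^sub>m M) $$ (i, j) * x $ j) +
        (\<Sum>j<n. (M * mat_exp (s \<cdot>\<^sub>m M)) $$ (i, j) * x $ j) * exp (- s) =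
        ((M * mat_exp (s \<cdot>\<^sub>m M)) *\<^sub>v x) $ i * exp (- s) - y s $ i"
      using M E x i fun_cong[OF yi, of s] by (subst mult_mat_vec_index_sum[of _ n]) auto
    also have "((M * mat_exp (s \<cdot>\<^sub>m M)) *\<^sub>v x) $ i * exp (- s) = (M *\<^sub>v y s) $ i"
      using M E[of s] x i Ex[of s]
      by (simp add: assoc_mult_mat_vec[of _ n n _ n] y_def mult.commute del: index_mult_mat_vec)
        (simp add: mult_mat_vec[of _ n n])
    also have "(M *\<^sub>v y s) $ i - y s $ i = ((M - 1\<^sub>m n) *\<^sub>v y s) $ i"
      using M y[of s] i by (simp add: minus_mult_distrib_mat_vec[of _ n n])
    finally show "((\<lambda>s. y s $ i) has_real_derivative ((M - 1\<^sub>m n) *\<^sub>v y s) $ i) (at s within {0..t})" .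
  qed (use M y \<open>0 \<le> t\<close> in auto)
  moreover have "y 0 = x"
    unfolding y_def using mat_exp_zero[OF M] x by simp
  ultimately show ?thesis
    by (simp add: y_def)
qed

text \<open>
  A half-space that contains all \<open>M\<^sup>m x\<close> contains \<open>exp (t (M - 1)) x\<close>, which is their average
  with respect to the Poisson distribution with parameter \<open>t\<close>.
\<close>

lemma mat_exp_diff_one_halfspace:
  assumes M: "M \<in> carrier_mat n n" and x: "x \<in> carrier_vec n" and "0 \<le> t"
    and iter: "\<And>m. (\<Sum>i<n. c i * (M ^\<^sub>m m *\<^sub>v x) $ i) \<le> \<beta>"
  shows "(\<Sum>i<n. c i * (mat_exp (t \<cdot>\<^sub>m (M - 1\<^sub>m n)) *\<^sub>v x) $ i) \<le> \<beta>"
proof -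
  have E: "mat_exp (t \<cdot>\<^sub>m M) \<in> carrier_mat n n"
    using M by simp
  let ?l = "\<lambda>m. \<Sum>i<n. c i * (M ^\<^sub>m m *\<^sub>v x) $ i"
  have "(\<lambda>m. \<Sum>i<n. c i * (\<Sum>j<n. (M ^\<^sub>m m) $$ (i, j) / fact m * t ^ m * x $ j)) sums
      (\<Sum>i<n. c i * (\<Sum>j<n. mat_exp (t \<cdot>\<^sub>m M) $$ (i, j) * x $ j))"
    using M by (intro sums_sum sums_mult sums_mult2 mat_exp_smult_sums) auto
  also have "(\<Sum>i<n. c i * (\<Sum>j<n. mat_exp (t \<cdot>\<^sub>m M) $$ (i, j) * x $ j)) =
      (\<Sum>i<n. c i * (mat_exp (t \<cdot>\<^sub>m M) *\<^sub>v x) $ i)"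
    using E x by (intro sum.cong refl) (simp add: mult_mat_vec_index_sum[of _ n] del: index_mult_mat_vec)
  also have "(\<lambda>m. \<Sum>i<n. c i * (\<Sum>j<n. (M ^\<^sub>m m) $$ (i, j) / fact m * t ^ m * x $ j)) =
      (\<lambda>m. t ^ m / fact m * ?l m)"
  proof
    fix m
    have "(M ^\<^sub>m m *\<^sub>v x) $ i = (\<Sum>j<n. (M ^\<^sub>m m) $$ (i, j) * x $ j)" if "i < n" for i
      using M x that by (intro mult_mat_vec_index_sum pow_carrier_mat)
    then show "(\<Sum>i<n. c i * (\<Sum>j<n. (M ^\<^sub>m m) $$ (i, j) / fact m * t ^ m * x $ j)) = t ^ m / fact m * ?l m"
      by (simp add: sum_distrib_left mult_ac)
  qed
  finally have l: "(\<lambda>m. t ^ m / fact m * ?l m) sums (\<Sum>i<n. c i * (mat_exp (t \<cdot>\<^sub>m M) *\<^sub>v x) $ i)" .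
  have \<beta>: "(\<lambda>m. t ^ m / fact m * \<beta>) sums (exp t * \<beta>)"
    using exp_converges[of t] by (intro sums_mult2) (simp add: field_simps)
  have "(\<Sum>i<n. c i * (mat_exp (t \<cdot>\<^sub>m M) *\<^sub>v x) $ i) \<le> exp t * \<beta>"
    by (rule sums_le[OF mult_left_mono[OF iter] l \<beta>]) (use \<open>0 \<le> t\<close> in simp)
  moreover have "(\<Sum>i<n. c i * (mat_exp (t \<cdot>\<^sub>m (M - 1\<^sub>m n)) *\<^sub>v x) $ i) =
      exp (- t) * (\<Sum>i<n. c i * (mat_exp (t \<cdot>\<^sub>m M) *\<^sub>v x) $ i)"
    unfolding mat_exp_diff_one[OF M x \<open>0 \<le> t\<close>] sum_distrib_left
    using E by (intro sum.cong refl) simp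
  moreover have "exp (- t) * (exp t * \<beta>) = \<beta>"
    by (simp add: exp_minus)
  ultimately show ?thesis
    by (metis exp_ge_zero mult_left_mono)
qed

subsection \<open>Sums of largest entries\<close>

text \<open>Induction by removing the maximum \<open>m\<close> of \<open>J\<close>: as
  \<open>J\<close> lies in \<open>{..m}\<close>, its last slot \<open>card J - 1\<close> is at most
  \<open>m\<close>, so \<open>f m\<close> is at most the last term on the right.\<close>

lemma sum_le_sum_initial_segment:
  fixes f :: "nat \<Rightarrow> real"
  assumes "\<And>i j. \<lbrakk>i \<le> j; j < n\<rbrakk> \<Longrightarrow> f j \<le> f i" and "J \<subseteq> {..<n}"
  shows "sum f J \<le> sum f {..<card J}"
proof -
  have "finite J" using assms(2) finite_subset by blast
  then show ?thesis using assms(2)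
  proof (induction "card J" arbitrary: J)
    case 0
    then show ?case by simp
  next
    case (Suc k)
    then have "J \<noteq> {}" by auto
    define m where "m = Max J"
    have m: "m \<in> J" "J \<subseteq> {..m}"
      using Suc.prems \<open>J \<noteq> {}\<close> by (auto simp: m_def)
    have "card J \<le> Suc m"
      using card_mono[OF _ m(2)] by simp
    then have "f m \<le> f k"
      using m Suc by (intro assms(1)) auto
    moreover have "sum f (J - {m}) \<le> sum f {..<card (J - {m})}"
      using Suc m by (intro Suc.hyps) auto
    moreover have "card (J - {m}) = k"
      using Suc m by simp
    moreover have "sum f J = f m + sum f (J - {m})"
      using Suc.prems m by (simp add: sum.remove)
    ultimately show ?case
      using Suc.hyps(2)[symmetric] by simp
  qed
qed

lemma sum_largest_eq_sum_nth:
  assumes "x \<in> carrier_vec n" "k \<le> n"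
  shows "sum_largest k x = (\<Sum>i<k. rev (sort (list_of_vec x)) ! i)"
  using assms by (simp add: sum_largest_def sum_list_sum_nth atLeast0LessThan min_def)

text \<open>Replaces the sorted list by a permutation of the indices, so that the largest entries
  can be handled as sums over index sets.\<close>

lemma sorting_permutation:
  fixes x :: "real vec"
  assumes "x \<in> carrier_vec n"
  obtains p where "p permutes {..<n}" "\<And>i j. \<lbrakk>i \<le> j; j < n\<rbrakk> \<Longrightarrow> x $ p j \<le> x $ p i"
    "\<And>k. k \<le> n \<Longrightarrow> sum_largest k x = (\<Sum>i<k. x $ p i)"
proof -
  let ?l = "list_of_vec x"
  have len: "length ?l = n"
    using assms by simp
  have "mset (rev (sort ?l)) = mset ?l"
    by simp
  then obtain p where p: "p permutes {..<n}" "permute_list p ?l = rev (sort ?l)"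
    using mset_eq_permutation len by metis
  have nth: "rev (sort ?l) ! i = x $ p i" if "i < n" for i
    using permute_list_nth[of p ?l i] p(1) that unfolding p(2)[symmetric] len list_of_vec_index by blast
  have "x $ p j \<le> x $ p i" if "i \<le> j" "j < n" for i j
  proof -
    have "sort ?l ! (n - Suc j) \<le> sort ?l ! (n - Suc i)"
      using that len by (intro sorted_nth_mono) auto
    then show ?thesis
      using nth[of i] nth[of j] that len by (simp add: rev_nth)
  qed
  moreover have "sum_largest k x = (\<Sum>i<k. x $ p i)" if "k \<le> n" for k
    unfolding sum_largest_eq_sum_nth[OF assms that] using nth that by (intro sum.cong) auto
  ultimately show thesis
    using that p(1) by blast
qed

text \<open>Pulling \<open>I\<close> back along the sorting permutation reduces this to decreasing
  entries. With \<open>sum_largest_attained\<close> it makes \<open>sum_largest k x\<close> a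
  maximum over the index sets of size \<open>k\<close>.\<close>

lemma sum_le_sum_largest:
  assumes "x \<in> carrier_vec n" "I \<subseteq> {..<n}"
  shows "(\<Sum>i\<in>I. x $ i) \<le> sum_largest (card I) x"
proof -
  obtain p where p: "p permutes {..<n}" "\<And>i j. \<lbrakk>i \<le> j; j < n\<rbrakk> \<Longrightarrow> x $ p j \<le> x $ p i"
    "\<And>k. k \<le> n \<Longrightarrow> sum_largest k x = (\<Sum>i<k. x $ p i)"
    using sorting_permutation[OF assms(1)] by blast
  let ?J = "inv_into UNIV p ` I"
  have surj: "surj p"
    using p(1) by (rule permutes_surj)
  have injI: "inj_on (inv_into UNIV p) I"
    by (rule inj_on_inv_into) (simp add: surj)
  have J: "?J \<subseteq> {..<n}" "card ?J = card I"
    using image_mono[OF assms(2)] permutes_image[OF permutes_inv[OF p(1)]] card_image[OF injI] by metis+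
  have "(\<Sum>i\<in>I. x $ i) = (\<Sum>j\<in>?J. x $ p j)"
    by (simp add: sum.reindex[OF injI] surj_f_inv_f[OF surj])
  also have "\<dots> \<le> (\<Sum>j<card ?J. x $ p j)"
    using p(2) J(1) by (intro sum_le_sum_initial_segment)
  also have "\<dots> = sum_largest (card I) x"
    using p(3)[of "card I"] card_mono[OF _ assms(2)] unfolding J(2) by simp
  finally show ?thesis .
qed

lemma sum_largest_attained:
  assumes "x \<in> carrier_vec n" "k \<le> n"
  obtains I where "I \<subseteq> {..<n}" "card I = k" "sum_largest k x = (\<Sum>i\<in>I. x $ i)"
proof -
  obtain p where p: "p permutes {..<n}" "\<And>k. k \<le> n \<Longrightarrow> sum_largest k x = (\<Sum>i<k. x $ p i)"
    using sorting_permutation[OF assms(1)] by metis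
  have inj: "inj_on p {..<k}"
    using permutes_inj[OF p(1)] by (rule inj_on_subset) simp
  show thesis
  proof
    have "{..<k} \<subseteq> {..<n}"
      using assms(2) by auto
    then show "p ` {..<k} \<subseteq> {..<n}"
      using image_mono permutes_image[OF p(1)] by metis
    show "card (p ` {..<k}) = k"
      using inj by (simp add: card_image)
    show "sum_largest k x = (\<Sum>i\<in>p ` {..<k}. x $ i)"
      unfolding p(2)[OF assms(2)] sum.reindex[OF inj] by simp
  qed
qed

text \<open>\<open>D k\<close> is the entry of rank \<open>k + 1\<close>. A geometric
  \<open>d\<close> is monotone, so in decreasing order neighbouring entries have ratio
  \<open>min q (1/q)\<close>: one inequality is an equality, the other follows by comparing
  \<open>q * q\<close> with 1. Constancy of the ratio is what makes this hold at every rank.\<close>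

lemma sum_largest_geometric_gaps:
  assumes d: "d \<in> carrier_vec n" and pos: "\<And>i. i < n \<Longrightarrow> 0 < d $ i" and "0 < q"
    and ratio: "\<And>j. Suc j < n \<Longrightarrow> d $ Suc j = q * d $ j"
    and "Suc k < n"
  defines "D \<equiv> \<lambda>k. sum_largest (Suc k) d - sum_largest k d"
  shows "D (Suc k) \<le> q * D k" "q * D (Suc k) \<le> D k"
proof -
  let ?l = "list_of_vec d"
  have len: "length ?l = n"
    using d by simp
  have D: "D k = rev (sort ?l) ! k" if "k < n" for k
    using that unfolding D_def by (subst (1 2) sum_largest_eq_sum_nth[OF d]) auto
  have "D (Suc k) \<le> q * D k \<and> q * D (Suc k) \<le> D k"
  proof (cases "q \<le> 1")
    case True
    have "sorted (rev ?l)"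
      unfolding sorted_rev_iff_nth_Suc
      using ratio pos True d by (auto simp: list_of_vec_index intro!: mult_left_le_one_le less_imp_le)
    then have "sort ?l = rev ?l"
      by (intro properties_for_sort) auto
    then have D': "D k = d $ k" if "k < n" for k
      using D[OF that] by (simp add: list_of_vec_index)
    have "q * (q * d $ k) \<le> 1 * (1 * d $ k)"
      using True \<open>0 < q\<close> pos[of k] \<open>Suc k < n\<close> by (intro mult_mono) auto
    then show ?thesis
      using D'[of k] D'[of "Suc k"] \<open>Suc k < n\<close> ratio[of k] by simp
  next
    case False
    have "sorted ?l"
      unfolding sorted_iff_nth_Suc using ratio pos False d by (auto simp: list_of_vec_index)
    then have "sort ?l = ?l"
      by (rule sorted_sort_id)
    then have D': "D k = d $ (n - Suc k)" if "k < n" for k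
      using D[OF that] that len by (simp add: rev_nth list_of_vec_index)
    \<comment> \<open>The entries of rank \<open>k + 2\<close> and \<open>k + 1\<close> sit at
      \<open>m\<close> and \<open>Suc m\<close>, because \<open>d\<close> is increasing
      here.\<close>
    define m where "m = n - Suc (Suc k)"
    have m: "n - Suc k = Suc m" "Suc m < n"
      using \<open>Suc k < n\<close> by (auto simp: m_def)
    have "1 * (1 * d $ m) \<le> q * (q * d $ m)"
      using False pos[of m] m by (intro mult_mono) auto
    then show ?thesis
      using D'[of k] D'[of "Suc k"] \<open>Suc k < n\<close> ratio[of m] m by (simp add: m_def)
  qed
  then show "D (Suc k) \<le> q * D k" "q * D (Suc k) \<le> D k"
    by auto
qed

subsection \<open>The generator on diagonal matrices\<close>

text \<open>The negative is the rate matrix of a birth-death chain. \<open>b k\<close> and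
  \<open>a k\<close> both belong to the bond between \<open>k - 1\<close> and \<open>k\<close>:
  \<open>b k\<close> is the rate up, \<open>a k\<close> the rate down. The chain is closed when
  \<open>a 0 = 0\<close> and \<open>b n = 0\<close>.\<close>

definition tridiag :: "nat \<Rightarrow> (nat \<Rightarrow> real) \<Rightarrow> (nat \<Rightarrow> real) \<Rightarrow> real mat" where
  "tridiag n a b = mat n n (\<lambda>(i, j). if i = j then b (Suc i) + a i
     else if j = Suc i then - a j else if i = Suc j then - b i else 0)"

lemma tridiag_carrier [simp]: "tridiag n a b \<in> carrier_mat n n"
  by (simp add: tridiag_def)

lemma tridiagonal_sum:
  fixes x :: "nat \<Rightarrow> 'a::comm_ring_1"
  assumes "i < n"
  shows "(\<Sum>j<n. (if i = j then u else if j = Suc i then v j else if i = Suc j then w else 0) * x j) =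
    u * x i + (if Suc i < n then v (Suc i) * x (Suc i) else 0) + (if 0 < i then w * x (i - 1) else 0)"
proof -
  \<comment> \<open>At \<open>i = 0\<close> truncated subtraction makes \<open>i - 1\<close> equal
    to \<open>i\<close>; the guard \<open>0 < i\<close> removes that spurious term.\<close>
  have "(if i = j then u else if j = Suc i then v j else if i = Suc j then w else 0) * x j =
      (if j = i then u * x i else 0) + (if j = Suc i then v (Suc i) * x (Suc i) else 0) +
      (if j = i - 1 then if 0 < i then w * x (i - 1) else 0 else 0)" for j
    by auto
  then show ?thesis
    using assms by (simp add: sum.distrib)
qed

section \<open>The GKSL operator on diagonal matrices\<close>

lemma mat_adjoint_index:
  assumes "V \<in> carrier_mat n m" "i < m" "j < n"
  shows "mat_adjoint V $$ (i, j) = conjugate (V $$ (j, i))"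
  using assms by (simp add: mat_adjoint_def mat_of_rows_index)

lemma mat_adjoint_carrier [simp]:
  "V \<in> carrier_mat n m \<Longrightarrow> mat_adjoint V \<in> carrier_mat m n"
  by (auto simp: mat_adjoint_def)

text \<open>\<open>G\<close> is the entry of \<open>mat_adjoint V * V\<close>. Its factor
  \<open>1\<close> gives it the shape of the sums in \<open>shifted_diagonal_sums\<close>, with
  constant weights.\<close>

lemma gksl_term_diag_index:
  fixes W :: "nat \<Rightarrow> nat \<Rightarrow> real"
  assumes W: "V = mat n n (\<lambda>(i, j). complex_of_real (W i j))"
    and x: "x \<in> carrier_vec n" and ij: "i < n" "j < n"
  defines "G \<equiv> \<Sum>k<n. complex_of_real (W k i) * 1 * complex_of_real (W k j)"
  shows "((1/2) \<cdot>\<^sub>m (mat_adjoint V * V * diag_of_vec x + diag_of_vec x * (mat_adjoint V * V))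
      - V * diag_of_vec x * mat_adjoint V) $$ (i, j) =
    1/2 * (G * x $ j + x $ i * G) - (\<Sum>k<n. complex_of_real (W i k) * x $ k * complex_of_real (W j k))"
proof -
  have V: "V \<in> carrier_mat n n"
    by (simp add: W)
  have W': "V $$ (i, j) = complex_of_real (W i j)" if "i < n" "j < n" for i j
    using that by (simp add: W)
  have G: "(mat_adjoint V * V) $$ (i, j) = G"
    using carrier_matD[OF mat_adjoint_carrier[OF V]] V ij
    by (simp add: G_def scalar_prod_def lessThan_atLeast0 mat_adjoint_index[OF V] W')
  have diag: "diag_of_vec x = mat_diag n (\<lambda>i. x $ i)"
    using x by (simp add: diag_of_vec_def)
  have A: "mat_adjoint V \<in> carrier_mat n n" "mat_adjoint V * V \<in> carrier_mat n n"
    using mat_adjoint_carrier[OF V] V by (blast intro: mult_carrier_mat)+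
  have "(V * diag_of_vec x * mat_adjoint V) $$ (i, j) =
      (\<Sum>k<n. complex_of_real (W i k) * x $ k * complex_of_real (W j k))"
    unfolding diag mat_diag_mult_right[OF V] using carrier_matD[OF A(1)] V ij
    by (simp add: scalar_prod_def lessThan_atLeast0 mat_adjoint_index[OF V] W')
  then show ?thesis
    using G carrier_matD[OF A(1)] carrier_matD[OF A(2)] V ij unfolding diag
    by (simp add: mat_diag_mult_right[OF A(2)] mat_diag_mult_left[OF A(2)])
qed

text \<open>The angle splits a weight in proportion 1 to \<open>q\<close>. Cancelling
  \<open>cos\<close> against \<open>arccos\<close> requires its argument to lie in the unit
  interval, which is read off from its square.\<close>

lemma cos_sq_theta:
  assumes "0 < q" "d $ k / d $ (k - 1) = q"
  shows "(cos (theta d k))\<^sup>2 = 1 / (1 + q)" "(sin (theta d k))\<^sup>2 = q / (1 + q)"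
proof -
  define u where "u = (1 + q) powr (- 1 / 2)"
  have "u\<^sup>2 = (1 + q) powr (- 1)"
    unfolding u_def power2_eq_square by (simp add: powr_add[symmetric])
  also have "\<dots> = 1 / (1 + q)"
    using \<open>0 < q\<close> by (simp add: powr_minus_divide)
  finally have u2: "u\<^sup>2 = 1 / (1 + q)" .
  have "0 \<le> u" unfolding u_def by simp
  moreover have "u\<^sup>2 \<le> 1\<^sup>2"
    unfolding u2 using \<open>0 < q\<close> by simp
  ultimately have "u \<le> 1"
    using power2_le_imp_le[of u 1] by simp
  then have "cos (theta d k) = u"
    unfolding theta_def assms(2) u_def[symmetric] using \<open>0 \<le> u\<close> by simp
  then show "(cos (theta d k))\<^sup>2 = 1 / (1 + q)" using u2 by simp
  then show "(sin (theta d k))\<^sup>2 = q / (1 + q)"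
    using \<open>0 < q\<close> unfolding sin_squared_eq by (simp add: field_simps)
qed

text \<open>A matrix supported on one off-diagonal has at most one nonzero entry per row and column,
  so distinct \<open>i\<close> and \<open>j\<close> never meet and diagonals stay diagonal. The two
  sums swap roles between \<open>sigma_plus\<close> and \<open>sigma_minus\<close>.\<close>

lemma shifted_diagonal_sums:
  fixes f :: "nat \<Rightarrow> real" and x :: "nat \<Rightarrow> complex"
  assumes "i < n" "j < n"
  shows "(\<Sum>k<n. complex_of_real (if i = Suc k then f i else 0) * x k *
      complex_of_real (if j = Suc k then f j else 0)) =
      (if i = j \<and> 0 < i then complex_of_real ((f i)\<^sup>2) * x (i - 1) else 0)"
    and "(\<Sum>k<n. complex_of_real (if k = Suc i then f k else 0) * x k *
      complex_of_real (if k = Suc j then f k else 0)) =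
      (if i = j \<and> Suc i < n then complex_of_real ((f (Suc i))\<^sup>2) * x (Suc i) else 0)"
proof -
  have "complex_of_real (if i = Suc k then f i else 0) * x k *
      complex_of_real (if j = Suc k then f j else 0) =
      (if k = i - 1 then if i = j \<and> 0 < i then complex_of_real ((f i)\<^sup>2) * x (i - 1) else 0 else 0)" for k
    by (auto simp: power2_eq_square)
  then show "(\<Sum>k<n. complex_of_real (if i = Suc k then f i else 0) * x k *
      complex_of_real (if j = Suc k then f j else 0)) =
      (if i = j \<and> 0 < i then complex_of_real ((f i)\<^sup>2) * x (i - 1) else 0)"
    using assms by auto
  have "complex_of_real (if k = Suc i then f k else 0) * x k *
      complex_of_real (if k = Suc j then f k else 0) =
      (if k = Suc i then if i = j then complex_of_real ((f (Suc i))\<^sup>2) * x (Suc i) else 0 else 0)" for k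
    by (auto simp: power2_eq_square)
  then show "(\<Sum>k<n. complex_of_real (if k = Suc i then f k else 0) * x k *
      complex_of_real (if k = Suc j then f k else 0)) =
      (if i = j \<and> Suc i < n then complex_of_real ((f (Suc i))\<^sup>2) * x (Suc i) else 0)"
    by simp
qed

text \<open>\<open>sigma_plus\<close> carries weight down each bond and \<open>sigma_minus\<close>
  carries it up, at rates equal to the squared amplitudes.\<close>

lemma gksl_sigma_diag:
  fixes q :: real
  assumes "0 < q" and ratio: "\<And>j. Suc j < n \<Longrightarrow> d $ Suc j / d $ j = q"
    and x: "x \<in> carrier_vec n"
  shows "gksl n [sigma_plus n d, sigma_minus n d] (diag_of_vec x) =
    diag_of_vec (map_mat complex_of_real
      (tridiag n (\<lambda>k. real (k * (n - k)) * (1 / (1 + q))) (\<lambda>k. real (k * (n - k)) * (q / (1 + q)))) *\<^sub>v x)"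
    (is "?L = diag_of_vec (map_mat complex_of_real ?B *\<^sub>v x)")
proof (rule eq_matI)
  let ?T = "\<lambda>V. (1/2) \<cdot>\<^sub>m (mat_adjoint V * V * diag_of_vec x + diag_of_vec x * (mat_adjoint V * V))
      - V * diag_of_vec x * mat_adjoint V"
  let ?y = "map_mat complex_of_real ?B *\<^sub>v x"
  have dims: "sigma_plus n d \<in> carrier_mat n n" "sigma_minus n d \<in> carrier_mat n n"
    by (auto simp: sigma_plus_def sigma_minus_def)
  have T: "?T V \<in> carrier_mat n n" if "V \<in> carrier_mat n n" for V
    using that mat_adjoint_carrier[OF that] x
    by (intro minus_carrier_mat mult_carrier_mat[of _ n n _ n]) (auto simp: diag_of_vec_def)
  have L: "?L = ?T (sigma_plus n d) + (?T (sigma_minus n d) + 0\<^sub>m n n)"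
    by (simp add: gksl_def)
  have y: "?y \<in> carrier_vec n"
    using x by (intro mult_mat_vec_carrier[of _ n n]) auto
  then have R: "diag_of_vec ?y \<in> carrier_mat n n"
    using mat_diag_dim[of "dim_vec ?y"] unfolding diag_of_vec_def carrier_vecD[OF y] by simp
  show "dim_row ?L = dim_row (diag_of_vec ?y)" "dim_col ?L = dim_col (diag_of_vec ?y)"
    unfolding L using T[OF dims(1)] T[OF dims(2)] R by auto
  fix i j
  assume "i < dim_row (diag_of_vec ?y)" "j < dim_col (diag_of_vec ?y)"
  then have ij: "i < n" "j < n"
    using R by auto
  define w where "w k = real (k * (n - k))" for k
  define a where "a k = sqrt (w k) * cos (theta d k)" for k
  define b where "b k = sqrt (w k) * sin (theta d k)" for k
  \<comment> \<open>At both ends the vanishing weight suppresses angles without meaning: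
    \<open>theta d 0\<close> compares an entry with itself and \<open>theta d n\<close> reads
    outside the vector.\<close>
  have w0: "w 0 = 0" "w n = 0" "a 0 = 0" "b n = 0"
    by (auto simp: w_def a_def b_def)
  have theta: "(cos (theta d k))\<^sup>2 = 1 / (1 + q)" "(sin (theta d k))\<^sup>2 = q / (1 + q)" if "0 < k" "k < n" for k
    using cos_sq_theta[OF \<open>0 < q\<close>, of d k] ratio[of "k - 1"] that by auto
  have sq: "(a k)\<^sup>2 = w k * (1 / (1 + q))" "(b k)\<^sup>2 = w k * (q / (1 + q))" if "k \<le> n" for k
  proof -
    have "0 \<le> w k" by (simp add: w_def)
    then show "(a k)\<^sup>2 = w k * (1 / (1 + q))" "(b k)\<^sup>2 = w k * (q / (1 + q))"
      using theta[of k] that w0 unfolding a_def b_def power_mult_distrib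
      by (cases "k = 0 \<or> k = n"; force)+
  qed
  have plus: "sigma_plus n d = mat n n (\<lambda>(i, j). complex_of_real (if j = Suc i then a j else 0))"
    and minus: "sigma_minus n d = mat n n (\<lambda>(i, j). complex_of_real (if i = Suc j then b i else 0))"
    by (auto intro!: eq_matI simp: sigma_plus_def sigma_minus_def a_def b_def w_def Let_def
        simp del: of_nat_mult mult_Suc)
  have Tp: "?T (sigma_plus n d) $$ (i, j) = (if i = j then complex_of_real ((a i)\<^sup>2) * x $ i -
      (if Suc i < n then complex_of_real ((a (Suc i))\<^sup>2) * x $ Suc i else 0) else 0)"
    unfolding gksl_term_diag_index[OF plus x ij] shifted_diagonal_sums[OF ij, where f = a]
    using w0 by auto
  have "b (Suc i) = 0" if "\<not> Suc i < n"
    using that ij w0 by (metis Suc_lessI)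
  then have Tm: "?T (sigma_minus n d) $$ (i, j) = (if i = j then complex_of_real ((b (Suc i))\<^sup>2) * x $ i -
      (if 0 < i then complex_of_real ((b i)\<^sup>2) * x $ (i - 1) else 0) else 0)"
    unfolding gksl_term_diag_index[OF minus x ij] shifted_diagonal_sums[OF ij, where f = b]
    by auto
  have "?y $ i = (\<Sum>j<n. complex_of_real (?B $$ (i, j)) * x $ j)"
    using ij x by (simp add: scalar_prod_def lessThan_atLeast0 tridiag_def)
  also have "\<dots> = (\<Sum>j<n. (if i = j then complex_of_real ((b (Suc i))\<^sup>2 + (a i)\<^sup>2)
      else if j = Suc i then - complex_of_real ((a j)\<^sup>2)
      else if i = Suc j then - complex_of_real ((b i)\<^sup>2) else 0) * x $ j)"
    using ij unfolding w_def[symmetric] by (intro sum.cong refl) (auto simp: tridiag_def sq)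
  also have "\<dots> = complex_of_real ((b (Suc i))\<^sup>2 + (a i)\<^sup>2) * x $ i
      + (if Suc i < n then - complex_of_real ((a (Suc i))\<^sup>2) * x $ (Suc i) else 0)
      + (if 0 < i then - complex_of_real ((b i)\<^sup>2) * x $ (i - 1) else 0)"
    using ij by (intro tridiagonal_sum)
  finally have yi: "?y $ i = \<dots>" .
  have diag: "diag_of_vec z $$ (i, j) = (if i = j then z $ i else 0)" if "z \<in> carrier_vec n" for z
    using that ij by (auto simp: diag_of_vec_def mat_diag_def)
  have add: "(X + (Y + 0\<^sub>m n n)) $$ (i, j) = X $$ (i, j) + Y $$ (i, j)"
    if "X \<in> carrier_mat n n" "Y \<in> carrier_mat n n" for X Y :: "complex mat"
    using that ij by auto
  show "?L $$ (i, j) = diag_of_vec ?y $$ (i, j)"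
    unfolding L add[OF T[OF dims(1)] T[OF dims(2)]] Tp Tm diag[OF y] yi
    by (auto simp: algebra_simps)
qed

text \<open>The definite description calls for uniqueness too: applied to the unit vector
  \<open>j\<close>, the diagonal entry \<open>i\<close> recovers the matrix entry, and
  \<open>complex_of_real\<close> is injective.\<close>

lemma B0_eqI:
  assumes B: "B \<in> carrier_mat n n"
    and diag: "\<And>x. x \<in> carrier_vec n \<Longrightarrow>
      \<Gamma> (diag_of_vec x) = diag_of_vec (map_mat complex_of_real B *\<^sub>v x)"
  shows "B0 n \<Gamma> = B"
  unfolding B0_def
proof (rule the_equality)
  show "B \<in> carrier_mat n n \<and> (\<forall>x\<in>carrier_vec n.
      diag_of_vec (map_mat complex_of_real B *\<^sub>v x) = \<Gamma> (diag_of_vec x))"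
    using assms by simp
next
  fix C
  assume C: "C \<in> carrier_mat n n \<and> (\<forall>x\<in>carrier_vec n.
      diag_of_vec (map_mat complex_of_real C *\<^sub>v x) = \<Gamma> (diag_of_vec x))"
  show "C = B"
  proof (rule eq_matI)
    fix i j
    assume "i < dim_row B" "j < dim_col B"
    then have ij: "i < n" "j < n" using B by auto
    let ?e = "unit_vec n j :: complex vec"
    have e: "?e \<in> carrier_vec n" by simp
    have "diag_of_vec (map_mat complex_of_real C *\<^sub>v ?e) = diag_of_vec (map_mat complex_of_real B *\<^sub>v ?e)"
      using bspec[OF conjunct2[OF C] e] diag[OF e] by (rule trans)
    then have "diag_of_vec (map_mat complex_of_real C *\<^sub>v ?e) $$ (i, i) =
        diag_of_vec (map_mat complex_of_real B *\<^sub>v ?e) $$ (i, i)"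
      by (rule arg_cong)
    then have "complex_of_real (C $$ (i, j)) = complex_of_real (B $$ (i, j))"
      using ij conjunct1[OF C] B by (simp add: diag_of_vec_def mat_diag_def)
    then show "C $$ (i, j) = B $$ (i, j)" by simp
  qed (use B C in auto)
qed

subsection \<open>Invariance of bounds on partial sums\<close>

text \<open>Bounding the sums over all index sets, not the sorted entries, presents the set as an
  intersection of half-spaces, as the averaging argument requires. For concave \<open>F\<close> with
  \<open>F 0 = 0\<close> it is the base polytope of the submodular function \<open>I\<close> to
  \<open>F (card I)\<close>.\<close>

definition sum_bounded :: "nat \<Rightarrow> (nat \<Rightarrow> real) \<Rightarrow> real vec set" where
  "sum_bounded n F = {x \<in> carrier_vec n.
     (\<forall>I\<subseteq>{..<n}. (\<Sum>i\<in>I. x $ i) \<le> F (card I)) \<and> (\<Sum>i<n. x $ i) = F n}"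

section \<open>Majorization and the simplex as bounds on partial sums\<close>

lemma sum_bounded_sum_largest:
  assumes "y \<in> carrier_vec n"
  shows "x \<in> sum_bounded n (\<lambda>k. sum_largest k y) \<longleftrightarrow> majorized n x y"
proof
  have total: "sum_largest n x = (\<Sum>i<n. x $ i)" if x: "x \<in> carrier_vec n" for x
  proof -
    obtain I where "I \<subseteq> {..<n}" "card I = n" "sum_largest n x = (\<Sum>i\<in>I. x $ i)"
      using sum_largest_attained[OF x, of n] by blast
    then show ?thesis
      using card_subset_eq[of "{..<n}" I] by simp
  qed
  {
    assume x: "x \<in> sum_bounded n (\<lambda>k. sum_largest k y)"
    then have xc: "x \<in> carrier_vec n"
      by (simp add: sum_bounded_def)
    have "sum_largest k x \<le> sum_largest k y" if "k \<le> n" for k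
      using sum_largest_attained[OF xc that] x unfolding sum_bounded_def
      by (metis (no_types, lifting) mem_Collect_eq)
    then show "majorized n x y"
      using x xc assms total[OF xc] by (auto simp: majorized_def sum_bounded_def)
  }
  assume m: "majorized n x y"
  then have xc: "x \<in> carrier_vec n"
    by (simp add: majorized_def)
  have "(\<Sum>i\<in>I. x $ i) \<le> sum_largest (card I) y" if I: "I \<subseteq> {..<n}" for I
  \<comment> \<open>\<open>majorized\<close> starts at \<open>k = 1\<close>, so the empty set is
    treated separately.\<close>
  proof (cases "I = {}")
    case True
    then show ?thesis by (simp add: sum_largest_def)
  next
    case False
    then have "card I \<in> {1..n}"
      using card_mono[OF _ I] I finite_subset by (auto simp: Suc_le_eq card_gt_0_iff)
    then show ?thesis
      using sum_le_sum_largest[OF xc I] m unfolding majorized_def by fastforce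
  qed
  then show "x \<in> sum_bounded n (\<lambda>k. sum_largest k y)"
    using xc m total[OF xc] by (auto simp: sum_bounded_def majorized_def)
qed

text \<open>With total 1, nonnegativity of an entry is the bound 1 on the sum over the complementary
  index set.\<close>

lemma sum_bounded_min_1:
  assumes "0 < n"
  shows "sum_bounded n (\<lambda>k. min 1 (real k)) = std_simplex n"
proof (intro equalityI subsetI)
  fix x
  assume x: "x \<in> sum_bounded n (\<lambda>k. min 1 (real k))"
  then have total: "(\<Sum>i<n. x $ i) = 1"
    using assms by (simp add: sum_bounded_def)
  have "0 \<le> x $ i" if "i < n" for i
  proof -
    have le: "(\<Sum>j\<in>I. x $ j) \<le> 1" if "I \<subseteq> {..<n}" for I
      using x that by (simp add: sum_bounded_def)
    have "(\<Sum>j\<in>{..<n} - {i}. x $ j) \<le> 1"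
      by (rule le) blast
    moreover have "1 = x $ i + (\<Sum>j\<in>{..<n} - {i}. x $ j)"
      unfolding total[symmetric] using that by (intro sum.remove) auto
    ultimately show ?thesis
      by linarith
  qed
  then show "x \<in> std_simplex n"
    using x total by (simp add: std_simplex_def sum_bounded_def)
next
  fix x
  assume x: "x \<in> std_simplex n"
  have "(\<Sum>i\<in>I. x $ i) \<le> min 1 (real (card I))" if I: "I \<subseteq> {..<n}" for I
  proof (cases "I = {}")
    case False
    then have "0 < card I"
      using finite_subset[OF I] by (simp add: card_gt_0_iff)
    moreover have "(\<Sum>i\<in>I. x $ i) \<le> (\<Sum>i<n. x $ i)"
      using x I by (intro sum_mono2) (auto simp: std_simplex_def)
    ultimately show ?thesis
      using x by (simp add: std_simplex_def Suc_le_eq)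
  qed simp
  then show "x \<in> sum_bounded n (\<lambda>k. min 1 (real k))"
    using x assms by (simp add: sum_bounded_def std_simplex_def)
qed

text \<open>The bounds depend only on cardinality, and permuting entries merely replaces an index
  set by another of the same size.\<close>

lemma permutation_mat_sum_bounded:
  assumes "P \<in> permutation_mats n" "x \<in> sum_bounded n F"
  shows "P *\<^sub>v x \<in> sum_bounded n F"
proof -
  obtain p where p: "p permutes {..<n}" and P: "P = mat n n (\<lambda>(i, j). if i = p j then 1 else 0)"
    using assms(1) by (auto simp: permutation_mats_def)
  define r where "r = inv_into UNIV p"
  have r: "r permutes {..<n}"
    unfolding r_def using p by (rule permutes_inv)
  have x: "x \<in> carrier_vec n"
    using assms(2) by (simp add: sum_bounded_def)
  have Px: "(P *\<^sub>v x) $ i = x $ r i" if "i < n" for i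
  proof -
    have "(P *\<^sub>v x) $ i = (\<Sum>j<n. (if i = p j then 1 else 0) * x $ j)"
      using that x by (simp add: P mult_mat_vec_index_sum[of _ n] del: index_mult_mat_vec)
    also have "\<dots> = (\<Sum>j<n. if j = r i then x $ j else 0)"
    proof (intro sum.cong refl)
      fix j
      have "i = p j \<longleftrightarrow> j = r i"
        using permutes_inv_eq[OF p, of i j] unfolding r_def by auto
      then show "(if i = p j then 1 else 0) * x $ j = (if j = r i then x $ j else 0)"
        by simp
    qed
    also have "\<dots> = x $ r i"
      using permutes_in_image[OF r, of i] that by simp
    finally show ?thesis .
  qed
  have sums: "(\<Sum>i\<in>I. (P *\<^sub>v x) $ i) = (\<Sum>i\<in>r ` I. x $ i)" "card (r ` I) = card I" "r ` I \<subseteq> {..<n}"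
    if I: "I \<subseteq> {..<n}" for I
  proof -
    have inj: "inj_on r I"
      using permutes_inj[OF r] by (rule inj_on_subset) simp
    have "(\<Sum>i\<in>I. (P *\<^sub>v x) $ i) = (\<Sum>i\<in>I. x $ r i)"
      using Px I by (intro sum.cong) auto
    then show "(\<Sum>i\<in>I. (P *\<^sub>v x) $ i) = (\<Sum>i\<in>r ` I. x $ i)"
      unfolding sum.reindex[OF inj] by simp
    show "card (r ` I) = card I"
      using inj by (rule card_image)
    show "r ` I \<subseteq> {..<n}"
      using image_mono[OF I] permutes_image[OF r] by metis
  qed
  have "P *\<^sub>v x \<in> carrier_vec n"
    using x by (intro mult_mat_vec_carrier[of _ n n]) (auto simp: P)
  moreover have "(\<Sum>i<n. (P *\<^sub>v x) $ i) = F n"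
    using sums(1)[of "{..<n}"] permutes_image[OF r] assms(2) by (simp add: sum_bounded_def)
  moreover have "(\<Sum>i\<in>I. (P *\<^sub>v x) $ i) \<le> F (card I)" if "I \<subseteq> {..<n}" for I
    using sums[OF that] assms(2) unfolding sum_bounded_def by (metis (no_types, lifting) mem_Collect_eq)
  ultimately show ?thesis
    by (simp add: sum_bounded_def)
qed

section \<open>Fluxes of the tridiagonal generator\<close>

lemma sum_by_parts:
  fixes f g :: "nat \<Rightarrow> real"
  shows "(\<Sum>i<n. f i * (g (Suc i) - g i)) = f n * g n - f 0 * g 0 + (\<Sum>i<n. (f i - f (Suc i)) * g (Suc i))"
  by (induction n) (auto simp: algebra_simps)

text \<open>\<open>J k\<close> is the net flux from \<open>k - 1\<close> to \<open>k\<close>, so the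
  generator acts as a discrete divergence with no flux through the two ends.\<close>

lemma tridiag_mult_vec_index:
  assumes "x \<in> carrier_vec n" "i < n" "a 0 = 0" "b n = 0"
  defines "J \<equiv> \<lambda>k. if 0 < k \<and> k < n then b k * x $ (k - 1) - a k * x $ k else 0"
  shows "(tridiag n a b *\<^sub>v x) $ i = J (Suc i) - J i"
proof -
  have "(tridiag n a b *\<^sub>v x) $ i = (\<Sum>j<n. (if i = j then b (Suc i) + a i else if j = Suc i then - a j
      else if i = Suc j then - b i else 0) * x $ j)"
    using assms(1,2) by (auto simp: mult_mat_vec_index_sum[of _ n] tridiag_def
        simp del: index_mult_mat_vec intro!: sum.cong)
  also have "\<dots> = (b (Suc i) + a i) * x $ i + (if Suc i < n then - a (Suc i) * x $ (Suc i) else 0) +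
      (if 0 < i then - b i * x $ (i - 1) else 0)"
    using assms(2) by (intro tridiagonal_sum)
  also have "\<dots> = J (Suc i) - J i"
  proof -
    have "b (Suc i) = 0" if "\<not> Suc i < n"
      using that assms(2,4) by (metis Suc_lessI)
    then show ?thesis
      using assms(2,3) by (cases "i = 0") (auto simp: J_def algebra_simps)
  qed
  finally show ?thesis .
qed

text \<open>\<open>F\<close> is kept abstract because the argument runs twice, for the simplex and
  for majorization. The gap conditions say that successive increments of \<open>F\<close> shrink at
  least by the factor \<open>min q (1/q)\<close>.\<close>

context
  fixes n :: nat and q :: real and w F :: "nat \<Rightarrow> real" and B :: "real mat"
  assumes q: "0 < q" and w: "\<And>k. 0 \<le> w k" "w 0 = 0" "w n = 0"
    and gaps: "\<And>k. Suc k < n \<Longrightarrow> F (Suc (Suc k)) - F (Suc k) \<le> q * (F (Suc k) - F k)"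
      "\<And>k. Suc k < n \<Longrightarrow> q * (F (Suc (Suc k)) - F (Suc k)) \<le> F (Suc k) - F k"
  defines "B \<equiv> tridiag n (\<lambda>k. w k * (1 / (1 + q))) (\<lambda>k. w k * (q / (1 + q)))"
begin

text \<open>
  If the bound for \<open>I\<close> holds with slack \<open>g\<close>, then the entries inside \<open>I\<close> are at least
  \<open>F k - F (k - 1) - g\<close> and those outside are at most \<open>F (k + 1) - F k + g\<close>, \<open>k\<close> being the
  cardinality of \<open>I\<close>.
\<close>

lemma slack_bounds:
  assumes x: "x \<in> sum_bounded n F" and I: "I \<subseteq> {..<n}" and "u \<in> I" "v < n" "v \<notin> I"
  defines "g \<equiv> F (card I) - (\<Sum>i\<in>I. x $ i)"
  shows "- ((1 + q) * g) \<le> q * x $ u - x $ v" "- ((1 + q) * g) \<le> x $ u - q * x $ v"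
proof -
  have fin: "finite I"
    using I finite_subset by blast
  have bound: "(\<Sum>i\<in>K. x $ i) \<le> F (card K)" if "K \<subseteq> {..<n}" for K
    using x that by (simp add: sum_bounded_def)
  obtain m where m: "card I = Suc m"
    using fin \<open>u \<in> I\<close> by (metis card_Suc_Diff1)
  have "card (insert v I) \<le> n"
    using I \<open>v < n\<close> card_mono[of "{..<n}" "insert v I"] by simp
  then have mn: "Suc m < n"
    using fin \<open>v \<notin> I\<close> m by simp
  have "(\<Sum>i\<in>I - {u}. x $ i) \<le> F m"
    using bound[of "I - {u}"] I fin \<open>u \<in> I\<close> m by auto
  then have u: "F (Suc m) - F m - g \<le> x $ u"
    using sum.remove[OF fin \<open>u \<in> I\<close>, of "\<lambda>i. x $ i"] m by (simp add: g_def)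
  have "(\<Sum>i\<in>insert v I. x $ i) \<le> F (Suc (Suc m))"
    using bound[of "insert v I"] I fin \<open>v < n\<close> \<open>v \<notin> I\<close> m by simp
  then have v: "x $ v \<le> F (Suc (Suc m)) - F (Suc m) + g"
    using fin \<open>v \<notin> I\<close> m by (simp add: g_def)
  \<comment> \<open>The entry scaled by \<open>q\<close> loses at most \<open>q * g\<close> and the
    other at most \<open>g\<close>; the remaining increments of \<open>F\<close> compare by the gap
    conditions.\<close>
  have "q * (F (Suc m) - F m - g) \<le> q * x $ u" "q * x $ v \<le> q * (F (Suc (Suc m)) - F (Suc m) + g)"
    using u v q by simp_all
  then show "- ((1 + q) * g) \<le> q * x $ u - x $ v" "- ((1 + q) * g) \<le> x $ u - q * x $ v"
    using u v gaps[OF mn] by (simp_all add: algebra_simps)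
qed

text \<open>Summation by parts against the indicator of \<open>I\<close> leaves only fluxes across
  bonds with exactly one end in \<open>I\<close>. Each is at least minus its weight times the slack.
  A bound linear in the slack is what permits one step size for all \<open>x\<close>.\<close>

lemma sum_generator_ge:
  assumes x: "x \<in> sum_bounded n F" and I: "I \<subseteq> {..<n}"
  shows "- ((\<Sum>i<n. w (Suc i)) * (F (card I) - (\<Sum>i\<in>I. x $ i))) \<le> (\<Sum>i\<in>I. (B *\<^sub>v x) $ i)"
    and "(\<Sum>i<n. (B *\<^sub>v x) $ i) = 0"
proof -
  define J where "J k = (if 0 < k \<and> k < n
    then w k * (q / (1 + q)) * x $ (k - 1) - w k * (1 / (1 + q)) * x $ k else 0)" for k
  have xc: "x \<in> carrier_vec n"
    using x by (simp add: sum_bounded_def)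
  have Bx: "(B *\<^sub>v x) $ i = J (Suc i) - J i" if "i < n" for i
    unfolding B_def J_def using tridiag_mult_vec_index[OF xc that] w by simp
  have J0: "J 0 = 0" "J n = 0"
    by (auto simp: J_def)
  show "(\<Sum>i<n. (B *\<^sub>v x) $ i) = 0"
    using Bx J0 sum_lessThan_telescope[of J n] by simp
  define g where "g = F (card I) - (\<Sum>i\<in>I. x $ i)"
  have g: "0 \<le> g"
    using x I by (simp add: g_def sum_bounded_def)
  let ?c = "\<lambda>i. if i \<in> I then 1 else 0 :: real"
  have "(\<Sum>i\<in>I. (B *\<^sub>v x) $ i) = (\<Sum>i<n. ?c i * (J (Suc i) - J i))"
    using Bx I by (intro sum.mono_neutral_cong_left) auto
  also have "\<dots> = (\<Sum>i<n. (?c i - ?c (Suc i)) * J (Suc i))"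
    using sum_by_parts[of ?c J n] J0 by simp
  also have "\<dots> \<ge> (\<Sum>i<n. - (w (Suc i) * g))"
  proof (rule sum_mono)
    fix i
    assume "i \<in> {..<n}"
    show "- (w (Suc i) * g) \<le> (?c i - ?c (Suc i)) * J (Suc i)"
    \<comment> \<open>On a boundary bond the sign of the indicator difference selects one of the two
      slack bounds. Otherwise the indicators agree or \<open>Suc i = n\<close>, where the flux
      vanishes.\<close>
    proof (cases "Suc i < n \<and> (i \<in> I \<longleftrightarrow> Suc i \<notin> I)")
      case True
      have J: "J (Suc i) = w (Suc i) / (1 + q) * (q * x $ i - x $ Suc i)"
        using True by (simp add: J_def right_diff_distrib)
      have "- ((1 + q) * g) \<le> (?c i - ?c (Suc i)) * (q * x $ i - x $ Suc i)"
        using True slack_bounds[OF x I, of i "Suc i"] slack_bounds[OF x I, of "Suc i" i]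
        by (auto simp: g_def)
      then have "w (Suc i) / (1 + q) * - ((1 + q) * g) \<le>
          w (Suc i) / (1 + q) * ((?c i - ?c (Suc i)) * (q * x $ i - x $ Suc i))"
        using w q by (intro mult_left_mono) auto
      moreover have "w (Suc i) / (1 + q) * - ((1 + q) * g) = - (w (Suc i) * g)"
        using q by simp
      ultimately show ?thesis
        unfolding J by (simp only: mult_ac)
    next
      case False
      then have "(?c i - ?c (Suc i)) * J (Suc i) = 0"
        by (auto simp: J_def)
      then show ?thesis
        using mult_nonneg_nonneg[OF w(1)[of "Suc i"] g] by (metis neg_le_0_iff_le)
    qed
  qed
  finally show "- ((\<Sum>i<n. w (Suc i)) * (F (card I) - (\<Sum>i\<in>I. x $ i))) \<le> (\<Sum>i\<in>I. (B *\<^sub>v x) $ i)"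
    by (simp add: sum_negf sum_distrib_right g_def)
qed

text \<open>One explicit Euler step \<open>M\<close> raises a partial sum by at most
  \<open>h * W\<close> times its slack, hence never past the bound; the powers of \<open>M\<close>
  then pass this on to the exponential.\<close>

lemma mat_exp_generator_sum_bounded:
  assumes x: "x \<in> sum_bounded n F" and "0 \<le> t"
  shows "mat_exp ((- t) \<cdot>\<^sub>m B) *\<^sub>v x \<in> sum_bounded n F"
proof -
  define W where "W = (\<Sum>i<n. w (Suc i))"
  \<comment> \<open>Adding 1 keeps \<open>h\<close> positive and well defined even when
    \<open>W = 0\<close>.\<close>
  define h where "h = 1 / (W + 1)"
  have W: "0 \<le> W"
    unfolding W_def using w by (intro sum_nonneg)
  then have h: "0 < h" "h * W \<le> 1"
    by (auto simp: h_def)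
  have B: "B \<in> carrier_mat n n"
    by (simp add: B_def)
  define M where "M = 1\<^sub>m n - h \<cdot>\<^sub>m B"
  have M: "M \<in> carrier_mat n n"
    using B unfolding M_def by (intro minus_carrier_mat) simp
  have step: "M *\<^sub>v y \<in> sum_bounded n F" if y: "y \<in> sum_bounded n F" for y
  proof -
    have yc: "y \<in> carrier_vec n"
      using y by (simp add: sum_bounded_def)
    have My: "(M *\<^sub>v y) $ i = y $ i - h * (B *\<^sub>v y) $ i" if "i < n" for i
      using that B yc unfolding M_def
      by (simp add: minus_mult_distrib_mat_vec[of _ n n])
    have sums: "(\<Sum>i\<in>I. (M *\<^sub>v y) $ i) = (\<Sum>i\<in>I. y $ i) - h * (\<Sum>i\<in>I. (B *\<^sub>v y) $ i)"
      if "I \<subseteq> {..<n}" for I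
    proof -
      have "(\<Sum>i\<in>I. (M *\<^sub>v y) $ i) = (\<Sum>i\<in>I. y $ i - h * (B *\<^sub>v y) $ i)"
        using My that by (intro sum.cong) auto
      then show ?thesis
        by (simp only: sum_subtractf sum_distrib_left)
    qed
    have "(\<Sum>i\<in>I. (M *\<^sub>v y) $ i) \<le> F (card I)" if I: "I \<subseteq> {..<n}" for I
    proof -
      let ?g = "F (card I) - (\<Sum>i\<in>I. y $ i)"
      have "0 \<le> ?g"
        using y I by (simp add: sum_bounded_def)
      then have "h * W * ?g \<le> ?g"
        using h W by (intro mult_left_le_one_le) auto
      moreover have "h * - (W * ?g) \<le> h * (\<Sum>i\<in>I. (B *\<^sub>v y) $ i)"
        using sum_generator_ge(1)[OF y I] h unfolding W_def by (intro mult_left_mono) auto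
      ultimately show ?thesis
        unfolding sums[OF I] by (simp add: mult.assoc)
    qed
    moreover have "M *\<^sub>v y \<in> carrier_vec n"
      using M yc by (rule mult_mat_vec_carrier)
    moreover have "(\<Sum>i<n. (M *\<^sub>v y) $ i) = F n"
      using sums[OF order_refl] sum_generator_ge(2)[OF y order_refl] y by (simp add: sum_bounded_def)
    ultimately show ?thesis
      by (simp add: sum_bounded_def)
  qed
  have xc: "x \<in> carrier_vec n"
    using x by (simp add: sum_bounded_def)
  have iter: "M ^\<^sub>m m *\<^sub>v x \<in> sum_bounded n F" for m
  proof (induction m)
    case 0
    then show ?case using x xc M by simp
  next
    case (Suc m)
    have "M ^\<^sub>m Suc m *\<^sub>v x = M *\<^sub>v (M ^\<^sub>m m *\<^sub>v x)"
      unfolding pow_mat_Suc_left[OF M] by (rule assoc_mult_mat_vec[OF M pow_carrier_mat[OF M] xc])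
    then show ?case using step[OF Suc] by simp
  qed
  have gen: "(- t) \<cdot>\<^sub>m B = (t / h) \<cdot>\<^sub>m (M - 1\<^sub>m n)"
    using B h unfolding M_def by (intro eq_matI) auto
  have th: "0 \<le> t / h"
    using h \<open>0 \<le> t\<close> by simp
  let ?y = "mat_exp ((- t) \<cdot>\<^sub>m B) *\<^sub>v x"
  have half: "(\<Sum>i<n. c i * ?y $ i) \<le> \<beta>" if "\<And>m. (\<Sum>i<n. c i * (M ^\<^sub>m m *\<^sub>v x) $ i) \<le> \<beta>" for c \<beta>
    unfolding gen using M xc th that by (rule mat_exp_diff_one_halfspace)
  have ind: "(\<Sum>i<n. (if i \<in> I then 1 else 0) * z $ i) = (\<Sum>i\<in>I. z $ i)" if "I \<subseteq> {..<n}" for I and z :: "real vec"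
    using that by (intro sum.mono_neutral_cong_right) auto
  have upper: "(\<Sum>i\<in>I. ?y $ i) \<le> F (card I)" if I: "I \<subseteq> {..<n}" for I
    using half[of "\<lambda>i. if i \<in> I then 1 else 0" "F (card I)"] iter I
    unfolding ind[OF I] sum_bounded_def by blast
  \<comment> \<open>The total is an equality, so the reverse half-space is required as well.\<close>
  have "(\<Sum>i<n. - 1 * ?y $ i) \<le> - F n"
  proof (rule half)
    fix m
    have "(\<Sum>i<n. (M ^\<^sub>m m *\<^sub>v x) $ i) = F n"
      using iter[of m] by (simp only: sum_bounded_def mem_Collect_eq)
    then show "(\<Sum>i<n. - 1 * (M ^\<^sub>m m *\<^sub>v x) $ i) \<le> - F n"
      by (simp only: mult_minus1 sum_negf)
  qed
  then have "F n \<le> (\<Sum>i<n. ?y $ i)"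
    by (simp only: mult_minus1 sum_negf)
  then have "(\<Sum>i<n. ?y $ i) = F n"
    using upper[OF order_refl] unfolding card_lessThan by (rule antisym[rotated])
  moreover have "?y \<in> carrier_vec n"
    using B xc by (intro mult_mat_vec_carrier[of _ n n] mat_exp_carrier) auto
  ultimately show ?thesis
    using upper unfolding sum_bounded_def by blast
qed

end

subsection \<open>Reachable sets\<close>

text \<open>The post-switch states stay in \<open>C\<close> by induction, and any other time is
  reached by flowing from the last switch before it.\<close>

lemma reach_subset:
  assumes B: "B \<in> carrier_mat n n" and "x0 \<in> C"
    and perm: "\<And>P x. \<lbrakk>P \<in> permutation_mats n; x \<in> C\<rbrakk> \<Longrightarrow> P *\<^sub>v x \<in> C"
    and exp: "\<And>t x. \<lbrakk>0 \<le> t; x \<in> C\<rbrakk> \<Longrightarrow> mat_exp ((- t) \<cdot>\<^sub>m B) *\<^sub>v x \<in> C"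
  shows "reach n B x0 \<subseteq> C"
proof
  fix z
  assume "z \<in> reach n B x0"
  then obtain \<tau> P xs x t where sol: "toy_solution n B x0 \<tau> P xs x" and "0 \<le> t" and z: "z = x t"
    by (auto simp: reach_def)
  have \<tau>: "\<tau> 0 = 0" "\<And>k. \<tau> k \<le> \<tau> (Suc k)" "finite {k. \<tau> k \<le> t}"
    and P: "\<And>k. P k \<in> permutation_mats n"
    and xs: "xs 0 = x0" "\<And>k. xs (Suc k) = P k *\<^sub>v (mat_exp ((- (\<tau> (Suc k) - \<tau> k)) \<cdot>\<^sub>m B) *\<^sub>v xs k)"
    and x: "\<And>t. 0 \<le> t \<Longrightarrow> x t \<in> carrier_vec n" "\<And>k. \<tau> k < \<tau> (Suc k) \<Longrightarrow> x (\<tau> k) = xs k"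
    and deriv: "\<And>k t i. \<lbrakk>t \<in> {\<tau> k..<\<tau> (Suc k)}; i < n\<rbrakk> \<Longrightarrow>
      ((\<lambda>s. x s $ i) has_real_derivative - ((B *\<^sub>v x t) $ i)) (at t within {\<tau> k..<\<tau> (Suc k)})"
    using sol unfolding toy_solution_def by blast+
  have xsC: "xs k \<in> C" for k
  proof (induction k)
    case 0
    then show ?case using xs \<open>x0 \<in> C\<close> by simp
  next
    case (Suc k)
    then show ?case
      unfolding xs(2) using \<tau>(2)[of k] by (intro perm P exp) auto
  qed
  \<comment> \<open>The maximum exists as switching times do not accumulate. Taking the last index
    skips coinciding switches, so the interval from \<open>\<tau> k\<close> is nonempty and
    \<open>x (\<tau> k) = xs k\<close>.\<close>
  define k where "k = Max {k. \<tau> k \<le> t}"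
  have "0 \<in> {k. \<tau> k \<le> t}"
    using \<tau>(1) \<open>0 \<le> t\<close> by simp
  then have "{k. \<tau> k \<le> t} \<noteq> {}"
    by blast
  then have k: "\<tau> k \<le> t"
    using Max_in[OF \<tau>(3)] by (simp add: k_def)
  have k': "t < \<tau> (Suc k)"
    using Max_ge[OF \<tau>(3), of "Suc k"] by (force simp: k_def[symmetric])
  have "0 \<le> \<tau> k"
    using \<tau>(1,2) by (induction k) (auto intro: order_trans)
  have "x t = mat_exp ((t - \<tau> k) \<cdot>\<^sub>m (- B)) *\<^sub>v x (\<tau> k)"
  proof (rule linear_ode_solution_eq_mat_exp)
    show "- B \<in> carrier_mat n n" "\<tau> k \<le> t"
      using B k by auto
    fix s
    assume s: "s \<in> {\<tau> k..t}"
    then show xc: "x s \<in> carrier_vec n"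
      using x(1) \<open>0 \<le> \<tau> k\<close> by simp
    fix i
    assume i: "i < n"
    have "((\<lambda>s. x s $ i) has_real_derivative - ((B *\<^sub>v x s) $ i)) (at s within {\<tau> k..t})"
      using s k' i by (intro DERIV_subset[OF deriv[of s k i]]) auto
    also have "- ((B *\<^sub>v x s) $ i) = (- B *\<^sub>v x s) $ i"
      using B xc i by simp
    finally show "((\<lambda>s. x s $ i) has_real_derivative (- B *\<^sub>v x s) $ i) (at s within {\<tau> k..t})" .
  qed
  also have "(t - \<tau> k) \<cdot>\<^sub>m (- B) = (- (t - \<tau> k)) \<cdot>\<^sub>m B"
    by (intro eq_matI) (auto simp: left_diff_distrib)
  also have "x (\<tau> k) = xs k"
    using x(2) k k' by simp
  finally show "z \<in> C"
    unfolding z using exp[of "t - \<tau> k" "xs k"] xsC k by simp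
qed

theorem theorem3:
  fixes n :: nat and d :: "real vec"
  assumes "d \<in> std_simplex n"
    and "\<forall>i<n. 0 < d $ i"
    and "\<exists>q. \<forall>j. Suc j < n \<longrightarrow> d $ Suc j / d $ j = q"
  defines "B \<equiv> B0 n (gksl n [sigma_plus n d, sigma_minus n d])"
  shows "dissipative_generator n B \<and>
    reach n B d \<subseteq> {x \<in> std_simplex n. majorized n x d}"
proof -
  have d: "d \<in> carrier_vec n"
    using assms(1) by (simp add: std_simplex_def)
  have "0 < n"
    using assms(1) by (cases n) (auto simp: std_simplex_def)
  obtain q where q: "0 < q" and ratio: "\<And>j. Suc j < n \<Longrightarrow> d $ Suc j / d $ j = q"
  \<comment> \<open>For \<open>n = 1\<close> there is no ratio to constrain \<open>q\<close>, and 1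
    serves; otherwise \<open>q\<close> is positive as a quotient of the first two entries.\<close>
  proof (cases "n = 1")
    case True
    then show thesis using that[of 1] by simp
  next
    case False
    obtain q where q: "\<And>j. Suc j < n \<Longrightarrow> d $ Suc j / d $ j = q"
      using assms(3) by blast
    have "1 < n"
      using False \<open>0 < n\<close> by simp
    then have "0 < d $ Suc 0 / d $ 0"
      using assms(2) by simp
    then show thesis
      using that[of q] q q[of 0] \<open>1 < n\<close> by simp
  qed
  define w where "w k = real (k * (n - k))" for k
  have w: "\<And>k. 0 \<le> w k" "w 0 = 0" "w n = 0"
    by (auto simp: w_def)
  have B: "B = tridiag n (\<lambda>k. w k * (1 / (1 + q))) (\<lambda>k. w k * (q / (1 + q)))"
    unfolding B_def w_def by (intro B0_eqI tridiag_carrier gksl_sigma_diag q ratio)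
  then have Bc: "B \<in> carrier_mat n n"
    by simp
  have pos: "\<And>i. i < n \<Longrightarrow> 0 < d $ i"
    using assms(2) by blast
  have ratio': "d $ Suc j = q * d $ j" if "Suc j < n" for j
    using ratio[OF that] pos[of j] that nonzero_divide_eq_eq[of "d $ j" "d $ Suc j" q] by simp
  define S where "S = std_simplex n"
  define K where "K = {x. majorized n x d}"
  have S: "S = sum_bounded n (\<lambda>k. min 1 (real k))"
    unfolding S_def using sum_bounded_min_1[OF \<open>0 < n\<close>] by simp
  have K: "K = sum_bounded n (\<lambda>k. sum_largest k d)"
    unfolding K_def using sum_bounded_sum_largest[OF d] by blast
  \<comment> \<open>The increments of \<open>min 1 k\<close> are 1 followed by zeros, so the gap
    conditions hold for every positive \<open>q\<close>.\<close>
  have expS: "mat_exp ((- t) \<cdot>\<^sub>m B) *\<^sub>v x \<in> S" if "0 \<le> t" "x \<in> S" for t x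
    using that q unfolding S B
    by (intro mat_exp_generator_sum_bounded w) auto
  have expK: "mat_exp ((- t) \<cdot>\<^sub>m B) *\<^sub>v x \<in> K" if "0 \<le> t" "x \<in> K" for t x
    using that unfolding K B
    by (intro mat_exp_generator_sum_bounded w q sum_largest_geometric_gaps[OF d pos q ratio'])
  have "reach n B d \<subseteq> S \<inter> K"
  proof (rule reach_subset[OF Bc])
    show "d \<in> S \<inter> K"
      using assms(1) d by (simp add: S_def K_def majorized_def)
  qed (use expS expK permutation_mat_sum_bounded S K in auto)
  then show ?thesis
    using Bc expS unfolding dissipative_generator_def S_def K_def by blast
qed

end
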